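(* Let $f(x)=a_nx^n+\dots+a_0$ be a polynomial of degree $n\ge1$ with integer coefficients that is expansive, and let $\alpha$ be any root of $f$. Then \[ \frac{1}{|\alpha|-1}\le\begin{cases}\binom{n+1}{2}H(f)+\frac{n}{2} & \text{if }\alpha\in\mathbb{R},\\ \binom{n}{2}\,n!\,H(f)^{n-1}+\binom{n}{2}+1 & \text{if }\alpha\in\mathbb{C}\setminus\mathbb{R}.\end{cases}\]
   Context: A polynomial is expansive if all of its complex roots $\alpha$ satisfy $|\alpha|>1$. The height of $f$ is $H(f)=\max_{0\le i\le n}|a_i|$. *)

theory Defs
  imports "HOL-Computational_Algebra.Polynomial"
begin

definition expansive :: "complex poly \<Rightarrow> bool" where
  "expansive p \<longleftrightarrow> (\<forall>z. poly p z = 0 \<longrightarrow> cmod z > 1)"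

definition height :: "'a::linordered_idom poly \<Rightarrow> 'a" where
  "height f = Max ((\<lambda>i. \<bar>coeff f i\<bar>) ` {0..degree f})"

end

theory Submission
  imports
    Defs
    "Jordan_Normal_Form.Determinant"
    "HOL-Computational_Algebra.Field_as_Ring"
    "HOL-Computational_Algebra.Fundamental_Theorem_Algebra"
begin

text \<open>
  Put b = 1 / |\<alpha>| < 1. For real \<alpha> of sign \<epsilon>, the nonzero integer f(\<epsilon>) equals the sum over k of
  a_k \<epsilon>^k (1 - b^(n-k)), so it is at most 1 - b times H(f) n(n+1)/2.

  For nonreal \<alpha>, let E(t) be the matrix with entries a_(i-j) t^(2j) - a_(i+j) for 0 < i, j < n. (Its
  determinant at t = 1 is, up to sign, a_n^(n-1) times the product of 1 - \<alpha>_p \<alpha>_q over pairs p < q of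
  roots, but this formula is not needed.) A kernel vector of E(1) yields an antisymmetric Laurent
  polynomial V such that f V has no terms of degree 1, ..., n-1; comparing with the reversal
  x \<mapsto> 1/x and using that f is coprime to its reversed polynomial forces V = 0. Hence det E(1) is
  a nonzero integer. On the other hand det E(b) = 0, with kernel vector Im(\<alpha>^j), because \<alpha> and its
  conjugate are both roots. Expanding both determinants over permutations bounds their difference
  by (1 - b) C(n,2) n! H(f)^(n-1).
\<close>

section \<open>Sums over permutations and elementary estimates\<close>

text \<open>Since the supports are nested, choosing an image for the last index removes at least one unit of
  weight from every earlier index; this accounts for the term m - 1 - j.\<close>

lemma sum_permutes_prod_le:
  fixes w :: "nat \<Rightarrow> nat \<Rightarrow> nat" and C :: "nat \<Rightarrow> nat"
  assumes "\<And>j. j < m \<Longrightarrow> (\<Sum>i<m. w j i) \<le> C j + (m - 1 - j)"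
    and "\<And>j k i. j \<le> k \<Longrightarrow> k < m \<Longrightarrow> i < m \<Longrightarrow> w k i > 0 \<Longrightarrow> w j i > 0"
  shows "(\<Sum>p | p permutes {..<m}. \<Prod>j<m. w j (p j)) \<le> (\<Prod>j<m. C j)"
  using assms
proof (induction m arbitrary: w)
  case 0
  then show ?case by simp
next
  case (Suc m)
  let ?S = "{..<m}"
  have ins: "{..<Suc m} = insert m ?S" by auto
  \<comment> \<open>Each permutation of \<open>insert m ?S\<close> is uniquely
    \<open>transpose m b \<circ> q\<close> with \<open>q\<close> permuting \<open>?S\<close>; it
    sends \<open>m\<close> to \<open>b\<close>, so \<open>w m b\<close> factors out.\<close>
  have inner: "(\<Sum>q | q permutes ?S. \<Prod>j<Suc m. w j ((transpose m b \<circ> q) j))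
      \<le> w m b * (\<Prod>j<m. C j)" if b: "b \<le> m" for b
  proof (cases "w m b = 0")
    case True
    have "(\<Prod>j<Suc m. w j ((transpose m b \<circ> q) j)) = 0" if "q permutes ?S" for q
    proof -
      have "q m = m" using that by (simp add: permutes_def)
      then show ?thesis using True by simp
    qed
    then have "(\<Sum>q | q permutes ?S. \<Prod>j<Suc m. w j ((transpose m b \<circ> q) j)) = 0"
      by (intro sum.neutral) blast
    then show ?thesis by simp
  next
    case False
    have eq: "(\<Prod>j<Suc m. w j ((transpose m b \<circ> q) j)) = w m b * (\<Prod>j<m. w j (transpose m b (q j)))"
      if "q permutes ?S" for q
    proof -
      have "q m = m" using that by (simp add: permutes_def)
      then show ?thesis by (simp add: mult.commute)
    qed
    have tr: "transpose m b i < Suc m" if "i < Suc m" for i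
      using that b by (auto simp: transpose_def)
    \<comment> \<open>The induction hypothesis is applied to the weights with columns
      \<open>m\<close> and \<open>b\<close> exchanged, which moves the column already used out of
      range.\<close>
    have "(\<Sum>q | q permutes ?S. \<Prod>j<m. w j (transpose m b (q j))) \<le> (\<Prod>j<m. C j)"
    proof (rule Suc.IH)
      fix j assume j: "j < m"
      have "(\<Sum>i<Suc m. w j (transpose m b i)) = (\<Sum>i<Suc m. w j i)"
        by (rule sum.reindex_bij_witness[of _ "transpose m b" "transpose m b"]) (use tr in auto)
      also have "\<dots> \<le> C j + (m - j)" using Suc.prems(1)[of j] j by simp
      finally have "(\<Sum>i<m. w j (transpose m b i)) + w j b \<le> C j + (m - j)"
        by simp
      moreover have "w j b > 0" using Suc.prems(2)[of j m b] j b False by simp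
      ultimately show "(\<Sum>i<m. w j (transpose m b i)) \<le> C j + (m - 1 - j)" using j by linarith
    next
      fix j k i assume "j \<le> k" "k < m" "i < m" "w k (transpose m b i) > 0"
      then show "w j (transpose m b i) > 0" using Suc.prems(2)[of j k "transpose m b i"] tr[of i] by simp
    qed
    then have "w m b * (\<Sum>q | q permutes ?S. \<Prod>j<m. w j (transpose m b (q j)))
        \<le> w m b * (\<Prod>j<m. C j)"
      by (rule mult_le_mono2)
    moreover have "(\<Sum>q | q permutes ?S. \<Prod>j<Suc m. w j ((transpose m b \<circ> q) j))
        = w m b * (\<Sum>q | q permutes ?S. \<Prod>j<m. w j (transpose m b (q j)))"
      unfolding sum_distrib_left by (intro sum.cong refl eq) simp
    ultimately show ?thesis by simp
  qed
  have "(\<Sum>p | p permutes {..<Suc m}. \<Prod>j<Suc m. w j (p j))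
      = (\<Sum>b\<in>insert m ?S. \<Sum>q | q permutes ?S. \<Prod>j<Suc m. w j ((transpose m b \<circ> q) j))"
    unfolding ins by (subst sum_over_permutations_insert) auto
  also have "\<dots> \<le> (\<Sum>b\<in>insert m ?S. w m b * (\<Prod>j<m. C j))"
    by (rule sum_mono) (use inner in auto)
  also have "\<dots> = (\<Sum>b<Suc m. w m b) * (\<Prod>j<m. C j)"
    unfolding ins sum_distrib_right ..
  also have "\<dots> \<le> C m * (\<Prod>j<m. C j)" 
    using Suc.prems(1)[of m] by (intro mult_right_mono) auto
  finally show ?case by (simp add: mult.commute)
qed

text \<open>Exchanging the factors \<open>x k\<close> for \<open>y k\<close> one at a time, each
  exchange costs the difference of that factor times the bounds on all the others.\<close>

lemma abs_prod_diff_le: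
  fixes x y C :: "'a \<Rightarrow> real"
  assumes "finite S" and "\<And>j. j \<in> S \<Longrightarrow> \<bar>x j\<bar> \<le> C j" and "\<And>j. j \<in> S \<Longrightarrow> \<bar>y j\<bar> \<le> C j"
  shows "\<bar>prod x S - prod y S\<bar> \<le> (\<Sum>k\<in>S. \<bar>x k - y k\<bar> * prod C (S - {k}))"
  using assms
proof (induction S rule: finite_induct)
  case empty
  then show ?case by simp
next
  case (insert a S)
  have "prod x (insert a S) - prod y (insert a S) = (x a - y a) * prod x S + y a * (prod x S - prod y S)"
    using insert by (simp add: algebra_simps)
  then have "\<bar>prod x (insert a S) - prod y (insert a S)\<bar> \<le> \<bar>x a - y a\<bar> * \<bar>prod x S\<bar> + \<bar>y a\<bar> * \<bar>prod x S - prod y S\<bar>"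
    by (metis abs_mult abs_triangle_ineq)
  also have "\<dots> \<le> \<bar>x a - y a\<bar> * prod C S + C a * (\<Sum>k\<in>S. \<bar>x k - y k\<bar> * prod C (S - {k}))"
  proof (intro add_mono mult_mono)
    show "\<bar>prod x S\<bar> \<le> prod C S" unfolding abs_prod using insert by (intro prod_mono) auto
  qed (use insert in \<open>auto intro: order_trans[OF abs_ge_zero]\<close>)
  also have "C a * (\<Sum>k\<in>S. \<bar>x k - y k\<bar> * prod C (S - {k})) 
     = (\<Sum>k\<in>S. \<bar>x k - y k\<bar> * prod C (insert a S - {k}))"
    unfolding sum_distrib_left
  proof (rule sum.cong[OF refl])
    fix k assume "k \<in> S"
    then have "insert a S - {k} = insert a (S - {k})" using insert by auto
    then show "C a * (\<bar>x k - y k\<bar> * prod C (S - {k})) = \<bar>x k - y k\<bar> * prod C (insert a S - {k})"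
      using insert by simp
  qed
  finally show ?case using insert by simp
qed

lemma one_minus_power_le:
  fixes t :: real
  assumes "0 \<le> t" "t \<le> 1"
  shows "1 - t ^ k \<le> real k * (1 - t)"
  using Bernoulli_inequality[of "t - 1" k] assms by (simp add: algebra_simps)

lemma abs_coeff_le_height:
  fixes f :: "'a::linordered_idom poly"
  shows "\<bar>coeff f i\<bar> \<le> height f"
proof (cases "i \<le> degree f")
  case True
  then show ?thesis unfolding height_def by (intro Max_ge) auto
next
  case False
  have "\<bar>coeff f 0\<bar> \<le> height f" unfolding height_def by (intro Max_ge) auto
  with False show ?thesis by (simp add: coeff_eq_0)
qed

section \<open>Estimating the determinant through its expansion over permutations\<close>

text \<open>Transposed and with indices shifted to start at 0: the entry at (j, i) is that of E(t) in
  row i + 1 and column j + 1.\<close>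

definition root_pair_mat :: "nat \<Rightarrow> (nat \<Rightarrow> 'a::comm_ring_1) \<Rightarrow> 'a \<Rightarrow> 'a mat" where
  "root_pair_mat m a t =
    mat m m (\<lambda>(j, i). (if j \<le> i then a (i - j) * t ^ (2 * (j + 1)) else 0) - a (i + j + 2))"

lemma root_pair_mat_carrier: "root_pair_mat m a t \<in> carrier_mat m m"
  by (simp add: root_pair_mat_def)

lemma permutes_reverse: "(\<lambda>i. if i < m then m - 1 - i else i) permutes {..<m::nat}"
  by (rule bij_imp_permutes, rule bij_betw_byWitness[where f' = "\<lambda>i. m - 1 - i"]) auto

text \<open>The weight at row \<open>j\<close> and column \<open>i\<close> counts the summands of
  the matrix entry that can be nonzero: \<open>a (i - j)\<close> occurs if \<open>j \<le> i\<close>,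
  and \<open>a (i + j + 2)\<close> has index at most \<open>m + 1\<close> if
  \<open>i + j < m\<close>. Row \<open>j\<close> has total \<open>2 * (m - j)\<close>, which is
  \<open>Suc (m - j) + (m - 1 - j)\<close>, and both conditions weaken as \<open>j\<close>
  decreases. So \<open>sum_permutes_prod_le\<close> applies with \<open>Suc (m - j)\<close> as
  \<open>C j\<close>.\<close>

lemma sum_permutes_weights_le:
  "(\<Sum>p | p permutes {..<m}. \<Prod>j<m. of_bool (j \<le> p j) + of_bool (p j + j < m)) \<le> (fact (Suc m) :: nat)"
proof -
  have "(\<Sum>p | p permutes {..<m}. \<Prod>j<m. of_bool (j \<le> p j) + of_bool (p j + j < m)) 
      \<le> (\<Prod>j<m. Suc (m - j))"
  proof (rule sum_permutes_prod_le[where w = "\<lambda>j i. of_bool (j \<le> i) + of_bool (i + j < m)"])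
    fix j assume j: "j < m"
    have "{..<m} \<inter> Collect ((\<le>) j) = {j..<m}" "{..<m} \<inter> {i. i + j < m} = {..<m - j}"
      using j by auto
    then show "(\<Sum>i<m. of_bool (j \<le> i) + of_bool (i + j < m)) \<le> Suc (m - j) + (m - 1 - j)"
      using j by (simp add: sum.distrib)
  qed auto
  also have "(\<Prod>j<m. Suc (m - j)) = fact (Suc m)"
  proof -
    have "(\<Prod>j<m. Suc (m - j)) = (\<Prod>j\<in>{1..m}. Suc j)"
      by (rule prod.reindex_bij_witness[of _ "\<lambda>j. m - j" "\<lambda>j. m - j"]) auto
    also have "\<dots> = fact (Suc m)"
      by (induction m) (simp_all add: algebra_simps)
    finally show ?thesis .
  qed
  finally show ?thesis .
qed

text \<open>Reversing the order of the rows exchanges the two summands of each weight, so marking the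
  first one selects exactly half of the total.\<close>

lemma sum_permutes_marked_weight:
  fixes k m :: nat
  assumes k: "k < m"
  shows "2 * (\<Sum>p | p permutes {..<m}. of_bool (k \<le> p k) *
            (\<Prod>j\<in>{..<m} - {k}. of_bool (j \<le> p j) + of_bool (p j + j < m)))
       = (\<Sum>p | p permutes {..<m}. \<Prod>j<m. of_bool (j \<le> p j) + of_bool (p j + j < m) :: nat)"
proof -
  define r where "r = (\<lambda>i. if i < m then m - 1 - i else i)"
  define c where "c = (\<lambda>j i. of_bool (j \<le> i) + of_bool (i + j < m) :: nat)"
  have r: "r permutes {..<m}" unfolding r_def by (rule permutes_reverse)
  have flip: "j \<le> r i \<longleftrightarrow> i + j < m" "r i + j < m \<longleftrightarrow> j \<le> i" if "i < m" "j < m" for i j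
    using that by (auto simp: r_def)
  have cr: "c j (r i) = c j i" if "i < m" "j < m" for i j
    using that by (simp add: c_def flip)
  have pm: "p j < m" if "p permutes {..<m}" "j < m" for p j
    using permutes_in_image[OF that(1), of j] that(2) by simp
  have "(\<Sum>p | p permutes {..<m}. of_bool (k \<le> p k) * (\<Prod>j\<in>{..<m} - {k}. c j (p j)))
      = (\<Sum>p | p permutes {..<m}. of_bool (k \<le> (r \<circ> p) k) * (\<Prod>j\<in>{..<m} - {k}. c j ((r \<circ> p) j)))"
    by (rule setum_permutations_compose_left[OF r])
  also have "\<dots> = (\<Sum>p | p permutes {..<m}. of_bool (p k + k < m) * (\<Prod>j\<in>{..<m} - {k}. c j (p j)))"
    using k by (intro sum.cong refl arg_cong2[where f = "(*)"] prod.cong) (auto simp: flip cr pm)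
  finally have "2 * (\<Sum>p | p permutes {..<m}. of_bool (k \<le> p k) * (\<Prod>j\<in>{..<m} - {k}. c j (p j)))
      = (\<Sum>p | p permutes {..<m}. of_bool (k \<le> p k) * (\<Prod>j\<in>{..<m} - {k}. c j (p j)))
       + (\<Sum>p | p permutes {..<m}. of_bool (p k + k < m) * (\<Prod>j\<in>{..<m} - {k}. c j (p j)))"
    by simp
  also have "\<dots> = (\<Sum>p | p permutes {..<m}. c k (p k) * (\<Prod>j\<in>{..<m} - {k}. c j (p j)))"
    by (simp add: sum.distrib[symmetric] c_def distrib_right)
  also have "\<dots> = (\<Sum>p | p permutes {..<m}. \<Prod>j<m. c j (p j))"
    using k by (intro sum.cong refl, subst prod.remove[of _ k]) auto
  finally show ?thesis by (simp add: c_def)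
qed

text \<open>In each permutation the factors at 1 are exchanged for those at \<open>t\<close> one row
  at a time. In row \<open>k\<close> only the first summand depends on \<open>t\<close>, and it
  changes by at most \<open>2 * (k + 1) * (1 - t) * H\<close>. The remaining factors together with
  the mark on row \<open>k\<close> carry half of the total weight, which cancels the 2; summing
  \<open>k + 1\<close> over the rows gives the binomial coefficient.\<close>

lemma abs_det_root_pair_mat_diff_le:
  fixes a :: "nat \<Rightarrow> real"
  assumes H: "\<And>k. \<bar>a k\<bar> \<le> H" and a0: "\<And>k. k > Suc m \<Longrightarrow> a k = 0" and t: "0 \<le> t" "t \<le> 1"
  shows "\<bar>det (root_pair_mat m a 1) - det (root_pair_mat m a t)\<bar>
    \<le> (1 - t) * (real (Suc m choose 2) * fact (Suc m) * H ^ m)"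
proof -
  define c where "c = (\<lambda>j i. of_bool (j \<le> i) + of_bool (i + j < m) :: nat)"
  define e where "e = (\<lambda>t j i. (if j \<le> i then a (i - j) * t ^ (2 * (j + 1)) else 0) - a (i + j + 2))"
  define P where "P = {p. p permutes {..<m}}"
  have H0: "0 \<le> H" using H[of 0] by linarith
  have det: "det (root_pair_mat m a s) = (\<Sum>p\<in>P. signof p * (\<Prod>j<m. e s j (p j)))" for s
    unfolding det_def'[OF root_pair_mat_carrier] P_def e_def lessThan_atLeast0
    by (intro sum.cong refl arg_cong2[where f = "(*)"] prod.cong)
       (auto simp: root_pair_mat_def dest!: permutes_in_image[THEN iffD2, rotated])
  have e_le: "\<bar>e s j i\<bar> \<le> H * c j i" if s: "0 \<le> s" "s \<le> 1" for s j i
  proof -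
    have "\<bar>a (i - j) * s ^ (2 * (j + 1))\<bar> \<le> H * 1"
      unfolding abs_mult using power_le_one[OF s, of "2 * (j + 1)"] s H H0
      by (intro mult_mono) (auto simp del: power_Suc)
    moreover have "\<bar>a (i + j + 2)\<bar> \<le> H * of_bool (i + j < m)"
      using H[of "i + j + 2"] a0[of "i + j + 2"] by auto
    ultimately show ?thesis
      unfolding e_def c_def by (auto simp: algebra_simps intro: order_trans[OF abs_triangle_ineq4])
  qed
  have e_diff: "\<bar>e 1 j i - e t j i\<bar> \<le> H * (1 - t) * (2 * real (Suc j)) * of_bool (j \<le> i)" for j i
  proof (cases "j \<le> i")
    case True
    have "e 1 j i - e t j i = a (i - j) * (1 - t ^ (2 * (j + 1)))"
      using True by (simp add: e_def algebra_simps)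
    then have "\<bar>e 1 j i - e t j i\<bar> = \<bar>a (i - j)\<bar> * \<bar>1 - t ^ (2 * (j + 1))\<bar>"
      by (simp only: abs_mult)
    also have "\<bar>a (i - j)\<bar> * \<bar>1 - t ^ (2 * (j + 1))\<bar> \<le> H * (real (2 * (j + 1)) * (1 - t))"
      using one_minus_power_le[OF t, of "2 * (j + 1)"] power_le_one[OF t, of "2 * (j + 1)"] H0
      by (intro mult_mono H) auto
    finally show ?thesis using True by (simp add: mult_ac)
  qed (simp add: e_def)
  have "\<bar>det (root_pair_mat m a 1) - det (root_pair_mat m a t)\<bar>
      = \<bar>\<Sum>p\<in>P. signof p * ((\<Prod>j<m. e 1 j (p j)) - (\<Prod>j<m. e t j (p j)))\<bar>"
    unfolding det by (simp add: sum_subtractf right_diff_distrib)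
  also have "\<dots> \<le> (\<Sum>p\<in>P. \<bar>(\<Prod>j<m. e 1 j (p j)) - (\<Prod>j<m. e t j (p j))\<bar>)"
    by (rule order_trans[OF sum_abs], rule sum_mono) (simp add: abs_mult sign_def)
  also have "\<dots> \<le> (\<Sum>p\<in>P. \<Sum>k<m. \<bar>e 1 k (p k) - e t k (p k)\<bar> * (\<Prod>j\<in>{..<m} - {k}. H * c j (p j)))"
    using t by (intro sum_mono abs_prod_diff_le e_le) auto
  also have "\<dots> \<le> (\<Sum>p\<in>P. \<Sum>k<m. (H * (1 - t) * (2 * real (Suc k)) * of_bool (k \<le> p k)) *
        (\<Prod>j\<in>{..<m} - {k}. H * c j (p j)))"
    using H0 by (intro sum_mono mult_right_mono e_diff prod_nonneg) auto
  \<comment> \<open>The 2 stays beside the marked product so that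
    \<open>sum_permutes_marked_weight\<close> can absorb it once the sums are swapped.\<close>
  also have "\<dots> = (\<Sum>p\<in>P. \<Sum>k<m. (H ^ m * (1 - t) * real (Suc k)) *
        real (2 * (of_bool (k \<le> p k) * (\<Prod>j\<in>{..<m} - {k}. c j (p j)))))"
  proof (intro sum.cong refl)
    fix p k assume "k \<in> {..<m}"
    then have "H ^ m = H * H ^ card ({..<m} - {k})" by (cases m) simp_all
    then show "(H * (1 - t) * (2 * real (Suc k)) * of_bool (k \<le> p k)) * (\<Prod>j\<in>{..<m} - {k}. H * c j (p j))
      = (H ^ m * (1 - t) * real (Suc k)) *
        real (2 * (of_bool (k \<le> p k) * (\<Prod>j\<in>{..<m} - {k}. c j (p j))))"
      by (simp add: prod.distrib)
  qed
  also have "\<dots> = (\<Sum>k<m. (H ^ m * (1 - t) * real (Suc k)) *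
        real (2 * (\<Sum>p\<in>P. of_bool (k \<le> p k) * (\<Prod>j\<in>{..<m} - {k}. c j (p j)))))"
    unfolding sum_distrib_left of_nat_sum by (rule sum.swap)
  also have "\<dots> = (\<Sum>k<m. (H ^ m * (1 - t) * real (Suc k)) * real (\<Sum>p\<in>P. \<Prod>j<m. c j (p j)))"
    unfolding P_def c_def by (intro sum.cong refl, subst sum_permutes_marked_weight) auto
  also have "\<dots> = (H ^ m * (1 - t)) * (\<Sum>k<m. real (Suc k)) * real (\<Sum>p\<in>P. \<Prod>j<m. c j (p j))"
    unfolding sum_distrib_left sum_distrib_right ..
  also have "(\<Sum>k<m. real (Suc k)) = real (Suc m choose 2)"
    by (induction m) (simp_all add: numeral_2_eq_2)
  also have "(H ^ m * (1 - t)) * real (Suc m choose 2) * real (\<Sum>p\<in>P. \<Prod>j<m. c j (p j))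
      \<le> (H ^ m * (1 - t)) * real (Suc m choose 2) * fact (Suc m)"
  proof (rule mult_left_mono)
    have "real (\<Sum>p\<in>P. \<Prod>j<m. c j (p j)) \<le> real (fact (Suc m))"
      unfolding P_def c_def of_nat_le_iff by (rule sum_permutes_weights_le)
    then show "real (\<Sum>p\<in>P. \<Prod>j<m. c j (p j)) \<le> fact (Suc m)"
      by (simp only: of_nat_fact)
  qed (use H0 t in auto)
  finally show ?thesis by (simp add: mult_ac)
qed

section \<open>Kernel vectors, and singularity at t = 1 / |\<alpha>|\<close>

text \<open>Singularity is restated as an explicit linear system, used in one direction at 1 /
  |\<alpha>| and in the other at 1. As the matrix is stored transposed, the system belongs to its
  transpose, which has the same determinant.\<close>

lemma det_root_pair_mat_eq_0_iff:
  fixes a :: "nat \<Rightarrow> 'a::field"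
  shows "det (root_pair_mat m a t) = 0 \<longleftrightarrow>
    (\<exists>v. (\<exists>j<m. v j \<noteq> 0) \<and> (\<forall>i<m. (\<Sum>j<m.
      ((if j \<le> i then a (i - j) * t ^ (2 * (j + 1)) else 0) - a (i + j + 2)) * v j) = 0))"
    (is "_ \<longleftrightarrow> (\<exists>v. ?nz v \<and> ?ker v)")
proof -
  let ?A = "transpose_mat (root_pair_mat m a t)"
  have A: "?A \<in> carrier_mat m m" by (simp add: root_pair_mat_def)
  have mv: "?A *\<^sub>v vec m v = 0\<^sub>v m \<longleftrightarrow> ?ker v" for v
    by (auto simp: vec_eq_iff root_pair_mat_def scalar_prod_def lessThan_atLeast0)
  have nz: "vec m v \<noteq> 0\<^sub>v m \<longleftrightarrow> ?nz v" for v
    by (auto simp: vec_eq_iff)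
  have "det (root_pair_mat m a t) = 0 \<longleftrightarrow> (\<exists>u. u \<in> carrier_vec m \<and> u \<noteq> 0\<^sub>v m \<and> ?A *\<^sub>v u = 0\<^sub>v m)"
    using det_0_iff_vec_prod_zero_field[OF A] det_transpose[OF root_pair_mat_carrier, of m a t] by simp
  also have "\<dots> \<longleftrightarrow> (\<exists>v. ?nz v \<and> ?ker v)"
  proof
    assume "\<exists>u. u \<in> carrier_vec m \<and> u \<noteq> 0\<^sub>v m \<and> ?A *\<^sub>v u = 0\<^sub>v m"
    then obtain u where u: "u \<in> carrier_vec m" "u \<noteq> 0\<^sub>v m" "?A *\<^sub>v u = 0\<^sub>v m" by blast
    have "vec m (($) u) = u" using u(1) by auto
    then have "?nz (($) u) \<and> ?ker (($) u)" using nz[of "($) u"] mv[of "($) u"] u by simp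
    then show "\<exists>v. ?nz v \<and> ?ker v" by (rule exI[where x = "($) u"])
  next
    assume "\<exists>v. ?nz v \<and> ?ker v"
    then obtain v where v: "?nz v \<and> ?ker v" by (rule exE)
    have "vec m v \<noteq> 0\<^sub>v m" by (rule nz[THEN iffD2, OF conjunct1[OF v]])
    moreover have "?A *\<^sub>v vec m v = 0\<^sub>v m" by (rule mv[THEN iffD2, OF conjunct2[OF v]])
    ultimately show "\<exists>u. u \<in> carrier_vec m \<and> u \<noteq> 0\<^sub>v m \<and> ?A *\<^sub>v u = 0\<^sub>v m"
      by (intro exI[of _ "vec m v"] conjI vec_carrier)
  qed
  finally show ?thesis .
qed

text \<open>Since t^(2k) \<alpha>^k is the conjugate of \<alpha>^(-k) for t = 1 / |\<alpha>|,
  equation \<open>i\<close> for the vector Im(\<alpha>^(j+1)) is, up to sign, the imaginary part of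
  \<alpha>^(-i-1) f(\<alpha>) without its constant term a_(i+1). As f(\<alpha>) = 0, what remains is
  the real number -a_(i+1).\<close>

lemma det_root_pair_mat_inverse_cmod_root:
  fixes f :: "real poly" and \<alpha> :: complex
  assumes deg: "degree f = Suc m" and m: "m > 0"
    and root: "poly (map_poly of_real f) \<alpha> = 0" and nonreal: "\<alpha> \<notin> \<real>"
  shows "det (root_pair_mat m (coeff f) (1 / cmod \<alpha>)) = 0"
proof -
  let ?t = "1 / cmod \<alpha>" and ?a = "coeff f"
  have \<alpha>0: "\<alpha> \<noteq> 0" using nonreal by auto
  have sum0: "(\<Sum>k\<le>Suc m. of_real (?a k) * \<alpha> ^ k) = 0"
    using root deg by (simp add: poly_altdef coeff_map_poly degree_map_poly)
  have Im_scaled: "?t ^ (2 * k) * Im (\<alpha> ^ k) = - Im (inverse \<alpha> ^ k)" for k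
  proof -
    have "of_real (?t ^ 2) * \<alpha> = cnj (inverse \<alpha>)"
      using \<alpha>0 complex_norm_square[of \<alpha>] by (simp add: field_simps flip: of_real_power)
    then have "of_real (?t ^ (2 * k)) * \<alpha> ^ k = cnj (inverse \<alpha> ^ k)"
      by (metis complex_cnj_power of_real_power power_mult power_mult_distrib)
    then have "Im (of_real (?t ^ (2 * k)) * \<alpha> ^ k) = - Im (inverse \<alpha> ^ k)" by (simp only: cnj.sel)
    then show ?thesis by (simp only: Im_complex_of_real Re_complex_of_real times_complex.sel mult_zero_left add_0_right)
  qed
  have ker: "(\<Sum>j<m. ((if j \<le> i then ?a (i - j) * ?t ^ (2 * (j + 1)) else 0) - ?a (i + j + 2))
      * Im (\<alpha> ^ (j + 1))) = 0" if i: "i < m" for i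
  proof -
    have S1: "(\<Sum>j<m. if j \<le> i then of_real (?a (i - j)) * \<alpha> ^ (i - j) else 0)
        = (\<Sum>k\<le>i. of_real (?a k) * \<alpha> ^ k)"
    proof -
      have "(\<Sum>j<m. if j \<le> i then of_real (?a (i - j)) * \<alpha> ^ (i - j) else 0)
          = (\<Sum>j\<le>i. of_real (?a (i - j)) * \<alpha> ^ (i - j))"
        using i by (intro sum.mono_neutral_cong_right) auto
      also have "\<dots> = (\<Sum>k\<le>i. of_real (?a k) * \<alpha> ^ k)"
        by (rule sum.reindex_bij_witness[of _ "\<lambda>j. i - j" "\<lambda>j. i - j"]) auto
      finally show ?thesis .
    qed
    have S2: "(\<Sum>j<m. of_real (?a (i + j + 2)) * \<alpha> ^ (i + j + 2))
        = (\<Sum>k\<in>{i+2..Suc m}. of_real (?a k) * \<alpha> ^ k)"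
    proof -
      have "(\<Sum>j<m. of_real (?a (i + j + 2)) * \<alpha> ^ (i + j + 2))
          = (\<Sum>k\<in>{i+2..<i+2+m}. of_real (?a k) * \<alpha> ^ k)"
        by (rule sum.reindex_bij_witness[of _ "\<lambda>k. k - (i + 2)" "\<lambda>j. i + j + 2"]) auto
      also have "\<dots> = (\<Sum>k\<in>{i+2..Suc m}. of_real (?a k) * \<alpha> ^ k)"
        by (intro sum.mono_neutral_right) (auto simp: coeff_eq_0 deg)
      finally show ?thesis .
    qed
    \<comment> \<open>\<open>S1\<close> and \<open>S2\<close> cover every term of f(\<alpha>) except
      the one of degree \<open>i + 1\<close>.\<close>
    have "{..Suc m} = insert (Suc i) ({..i} \<union> {i+2..Suc m})" using i by auto
    then have "(\<Sum>k\<le>Suc m. of_real (?a k) * \<alpha> ^ k) = of_real (?a (Suc i)) * \<alpha> ^ Suc i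
        + ((\<Sum>k\<le>i. of_real (?a k) * \<alpha> ^ k) + (\<Sum>k\<in>{i+2..Suc m}. of_real (?a k) * \<alpha> ^ k))"
      by (subst sum.union_disjoint[symmetric]) auto
    then have all: "(\<Sum>k\<le>i. of_real (?a k) * \<alpha> ^ k) + (\<Sum>k\<in>{i+2..Suc m}. of_real (?a k) * \<alpha> ^ k)
        = - of_real (?a (Suc i)) * \<alpha> ^ Suc i"
      unfolding sum0 by (simp add: add_eq_0_iff)
    have factor: "(if j \<le> i then of_real (?a (i - j)) * \<alpha> ^ (i - j) else 0) + of_real (?a (i + j + 2)) * \<alpha> ^ (i + j + 2)
        = \<alpha> ^ Suc i * ((if j \<le> i then of_real (?a (i - j)) * inverse \<alpha> ^ (j + 1) else 0)
             + of_real (?a (i + j + 2)) * \<alpha> ^ (j + 1))" for j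
    proof -
      have "\<alpha> ^ (i - j) = \<alpha> ^ Suc i * inverse \<alpha> ^ (j + 1)" if "j \<le> i"
        using that \<alpha>0 by (simp add: power_diff field_simps)
      moreover have "\<alpha> ^ (i + j + 2) = \<alpha> ^ Suc i * \<alpha> ^ (j + 1)" by (simp add: power_add)
      ultimately show ?thesis by (simp add: algebra_simps del: power_Suc)
    qed
    have "\<alpha> ^ Suc i * (\<Sum>j<m. (if j \<le> i then of_real (?a (i - j)) * inverse \<alpha> ^ (j + 1) else 0)
             + of_real (?a (i + j + 2)) * \<alpha> ^ (j + 1))
        = (\<Sum>j<m. (if j \<le> i then of_real (?a (i - j)) * \<alpha> ^ (i - j) else 0)
             + of_real (?a (i + j + 2)) * \<alpha> ^ (i + j + 2))"
      unfolding sum_distrib_left by (intro sum.cong refl factor[symmetric])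
    also have "\<dots> = \<alpha> ^ Suc i * - of_real (?a (Suc i))"
      unfolding sum.distrib S1 S2 all by simp
    finally have eq: "(\<Sum>j<m. (if j \<le> i then of_real (?a (i - j)) * inverse \<alpha> ^ (j + 1) else 0)
             + of_real (?a (i + j + 2)) * \<alpha> ^ (j + 1)) = - of_real (?a (Suc i))"
      using \<alpha>0 by (simp only: mult_cancel_left power_not_zero simp_thms)
    have "(\<Sum>j<m. ((if j \<le> i then ?a (i - j) * ?t ^ (2 * (j + 1)) else 0) - ?a (i + j + 2)) * Im (\<alpha> ^ (j + 1)))
      = - Im (\<Sum>j<m. (if j \<le> i then of_real (?a (i - j)) * inverse \<alpha> ^ (j + 1) else 0)
             + of_real (?a (i + j + 2)) * \<alpha> ^ (j + 1))"
      unfolding Im_sum sum_negf[symmetric]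
    proof (rule sum.cong[OF refl])
      fix j
      show "((if j \<le> i then ?a (i - j) * ?t ^ (2 * (j + 1)) else 0) - ?a (i + j + 2)) * Im (\<alpha> ^ (j + 1))
        = - Im ((if j \<le> i then of_real (?a (i - j)) * inverse \<alpha> ^ (j + 1) else 0)
             + of_real (?a (i + j + 2)) * \<alpha> ^ (j + 1))"
        using Im_scaled[of "j + 1"] by (simp add: left_diff_distrib mult.assoc del: power_Suc)
    qed
    also have "\<dots> = 0" unfolding eq by simp
    finally show ?thesis .
  qed
  have "Im (\<alpha> ^ (0 + 1)) \<noteq> 0" using nonreal by (simp add: complex_is_Real_iff)
  then have "\<exists>j<m. Im (\<alpha> ^ (j + 1)) \<noteq> 0" using m by (intro exI[of _ 0] conjI)
  then show ?thesis unfolding det_root_pair_mat_eq_0_iff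
    by (intro exI[of _ "\<lambda>j. Im (\<alpha> ^ (j + 1))"] conjI allI impI ker)
qed

section \<open>Reversed polynomials, and nonsingularity at t = 1\<close>

text \<open>For \<open>degree p \<le> n\<close> this is x^n p(1/x). The monomial pads
  \<open>reflect_poly\<close>, which reverses only with respect to the actual degree of
  \<open>p\<close>.\<close>

definition reverse_poly :: "nat \<Rightarrow> 'a::comm_semiring_1 poly \<Rightarrow> 'a poly" where
  "reverse_poly n p = monom 1 (n - degree p) * reflect_poly p"

lemma poly_reverse_poly:
  fixes x :: "'a::field"
  assumes "degree p \<le> n" "x \<noteq> 0"
  shows "poly (reverse_poly n p) x = x ^ n * poly p (inverse x)"
  using assms by (simp add: reverse_poly_def poly_monom poly_reflect_poly_nz flip: power_add)

lemma degree_reverse_poly_le: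
  fixes p :: "'a::comm_semiring_1 poly"
  shows "degree p \<le> n \<Longrightarrow> degree (reverse_poly n p) \<le> n"
  using degree_mult_le[of "monom 1 (n - degree p)" "reflect_poly p"] degree_reflect_poly_le[of p]
    degree_monom_le[of "1::'a" "n - degree p"]
  by (simp add: reverse_poly_def)

lemma reverse_poly_eq_0_iff [simp]:
  fixes p :: "'a::idom poly"
  shows "reverse_poly n p = 0 \<longleftrightarrow> p = 0"
  by (simp add: reverse_poly_def)

text \<open>Multiplying by x makes both sides agree at 0 as well. This serves identities obtained by
  substituting 1/x.\<close>

lemma poly_eqI_nonzero:
  fixes p q :: "'a::{field,ring_char_0} poly"
  assumes "\<And>x. x \<noteq> 0 \<Longrightarrow> poly p x = poly q x"
  shows "p = q"
proof -
  have "monom 1 1 * p = monom 1 1 * q"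
    by (rule poly_eq_poly_eq_iff[THEN iffD1], rule ext) (use assms in \<open>auto simp: poly_monom\<close>)
  then show ?thesis by simp
qed

text \<open>A common divisor that is not a unit has a complex root z. Then z and 1/z are both roots
  of \<open>f\<close>, but they cannot both lie outside the unit circle.\<close>

lemma coprime_reverse_expansive:
  assumes "expansive f"
  shows "coprime f (reverse_poly (degree f) f)"
proof (rule coprimeI)
  fix d assume d: "d dvd f" "d dvd reverse_poly (degree f) f"
  have f0: "f \<noteq> 0"
    using assms unfolding expansive_def by (metis norm_zero not_one_less_zero poly_0)
  show "is_unit d"
  proof (rule ccontr)
    assume "\<not> is_unit d"
    moreover have "d \<noteq> 0" using d f0 by auto
    ultimately have "degree d > 0" by (simp add: is_unit_iff_degree)
    then obtain z where "poly d z = 0" using alg_closed_imp_poly_has_root by blast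
    then have z: "poly f z = 0" "poly (reverse_poly (degree f) f) z = 0"
      using d by (auto elim!: dvdE)
    have z1: "cmod z > 1" using z assms by (auto simp: expansive_def)
    then have "z \<noteq> 0" by auto
    with z(2) have "poly f (inverse z) = 0" by (simp add: poly_reverse_poly)
    then have "cmod (inverse z) > 1" using assms by (auto simp: expansive_def)
    moreover have "cmod (inverse z) < 1" using z1 by (simp add: norm_inverse inverse_less_1_iff)
    ultimately show False by simp
  qed
qed

lemma det_root_pair_mat_expansive:
  fixes f :: "complex poly"
  assumes deg: "degree f = Suc m" and exp: "expansive f"
  shows "det (root_pair_mat m (coeff f) 1) \<noteq> 0"
proof
  assume "det (root_pair_mat m (coeff f) 1) = 0"
  then obtain v :: "nat \<Rightarrow> complex" and k where k: "k < m" "v k \<noteq> 0"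
    and ker: "\<And>i. i < m \<Longrightarrow> (\<Sum>j<m. ((if j \<le> i then coeff f (i - j) else 0) - coeff f (i + j + 2)) * v j) = 0"
    unfolding det_root_pair_mat_eq_0_iff power_one mult_1_right by blast
  define n where "n = Suc m"
  \<comment> \<open>This is the antisymmetric Laurent polynomial multiplied by x^n: the exponents
    \<open>n + j + 1\<close> and \<open>m - j\<close> are symmetric about \<open>n\<close>.\<close>
  define V where "V = (\<Sum>j<m. Polynomial.smult (v j) (monom 1 (n + j + 1) - monom 1 (m - j)))"
  define W where "W = f * V"
  define A where "A = poly_shift (2 * n) W"
  define C where "C = poly_cutoff (n + 1) W"
  let ?r = "reverse_poly n"
  have degf: "degree f = n" using deg by (simp add: n_def)
  have f0: "f \<noteq> 0" using deg by auto
  have coeff_V: "coeff V (n + k + 1) = v k"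
  proof -
    have "coeff V (n + k + 1) = (\<Sum>j<m. if j = k then v j else 0)"
      unfolding V_def coeff_sum by (intro sum.cong refl) (auto simp: n_def)
    then show ?thesis using k by simp
  qed
  have degV: "degree V \<le> 2 * m + 1"
    unfolding V_def n_def
    by (intro degree_sum_le finite_lessThan order_trans[OF degree_smult_le] degree_diff_le
          order_trans[OF degree_monom_le]) auto
  have degW: "degree W \<le> 3 * m + 2"
    unfolding W_def using degV deg degree_mult_le[of f V] by linarith
  \<comment> \<open>The kernel equations say exactly that \<open>W\<close> has no terms of degree
    \<open>n + 1\<close> up to \<open>2 * n - 1\<close>.\<close>
  have gap: "coeff W (n + i + 1) = 0" if "i < m" for i
  proof -
    have "coeff W (n + i + 1) = (\<Sum>j<m. ((if j \<le> i then coeff f (i - j) else 0) - coeff f (i + j + 2)) * v j)"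
      unfolding W_def V_def sum_distrib_left coeff_sum
    proof (intro sum.cong refl)
      fix j assume "j \<in> {..<m}"
      then have "n + i + 1 - (m - j) = i + j + 2" "\<not> n + i + 1 < m - j" by (auto simp: n_def)
      then have "coeff (monom 1 (m - j) * f) (n + i + 1) = coeff f (i + j + 2)"
        by (simp add: coeff_monom_mult)
      moreover have "coeff (monom 1 (n + j + 1) * f) (n + i + 1) = (if j \<le> i then coeff f (i - j) else 0)"
        by (auto simp: coeff_monom_mult)
      moreover have "f * Polynomial.smult (v j) (monom 1 (n + j + 1) - monom 1 (m - j))
          = Polynomial.smult (v j) (monom 1 (n + j + 1) * f - monom 1 (m - j) * f)"
        by (simp add: mult.commute[of f] left_diff_distrib)
      ultimately show "coeff (f * Polynomial.smult (v j) (monom 1 (n + j + 1) - monom 1 (m - j))) (n + i + 1)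
        = ((if j \<le> i then coeff f (i - j) else 0) - coeff f (i + j + 2)) * v j"
        by (simp only: coeff_smult coeff_diff mult.commute)
    qed
    then show ?thesis using ker[OF that] by simp
  qed
  have W: "W = C + monom 1 (2 * n) * A"
  proof (rule poly_eqI)
    fix l
    show "coeff W l = coeff (C + monom 1 (2 * n) * A) l"
    proof (cases "n + 1 \<le> l \<and> l < 2 * n")
      case True
      then obtain i where "l = n + i + 1" using le_Suc_ex[of "n + 1" l] by auto
      then show ?thesis using True gap[of i]
        by (simp add: C_def coeff_poly_cutoff coeff_monom_mult n_def)
    next
      case False
      \<comment> \<open>As \<open>n + 1 \<le> 2 * n\<close>, a degree outside the gap belongs to
        exactly one of \<open>C\<close> and the shifted \<open>A\<close>.\<close>
      then have "l < n + 1 \<and> l < 2 * n \<or> \<not> l < n + 1 \<and> \<not> l < 2 * n"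
        using k(1) unfolding n_def by auto
      then show ?thesis
        by (elim disjE conjE) (simp_all add: C_def A_def coeff_poly_cutoff coeff_poly_shift coeff_monom_mult)
    qed
  qed
  have degA: "degree A \<le> m"
    by (rule degree_le) (use degW in \<open>auto simp: A_def coeff_poly_shift n_def intro!: coeff_eq_0\<close>)
  then have degA': "degree A \<le> n" by (simp add: n_def)
  have degC: "degree C \<le> n"
    by (rule degree_le) (auto simp: C_def coeff_poly_cutoff)
  have V_odd: "x ^ (2 * n) * poly V (inverse x) = - poly V x" if "x \<noteq> 0" for x
  proof -
    have "x ^ (2 * n) * inverse x ^ (n + j + 1) = x ^ (m - j)"
         "x ^ (2 * n) * inverse x ^ (m - j) = x ^ (n + j + 1)" if "j < m" for j
    proof -
      have "2 * n = (n + j + 1) + (m - j)" using that by (simp add: n_def)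
      then have "x ^ (2 * n) = x ^ (n + j + 1) * x ^ (m - j)" by (simp only: power_add)
      moreover have "x ^ l * inverse x ^ l = 1" for l
        using \<open>x \<noteq> 0\<close> by (simp flip: power_mult_distrib)
      ultimately show "x ^ (2 * n) * inverse x ^ (n + j + 1) = x ^ (m - j)"
         "x ^ (2 * n) * inverse x ^ (m - j) = x ^ (n + j + 1)"
        by (metis mult.assoc mult.commute mult_1)+
    qed
    then show ?thesis
      unfolding V_def poly_sum sum_distrib_left sum_negf[symmetric]
      by (intro sum.cong refl) (simp add: poly_monom algebra_simps del: power_Suc power_inverse)
  qed
  \<comment> \<open>Substitute 1/x into \<open>W = C + monom 1 (2 * n) * A\<close>, multiply by
    x^(3n) and use \<open>V_odd\<close>.\<close>
  have rV: "?r f * V = - (monom 1 (2 * n) * ?r C + ?r A)"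
  proof (rule poly_eqI_nonzero)
    fix x :: complex assume x: "x \<noteq> 0"
    have "poly (?r f * V) x = x ^ n * poly f (inverse x) * - (x ^ (2 * n) * poly V (inverse x))"
      using x degf by (simp add: poly_reverse_poly V_odd)
    also have "\<dots> = - (x ^ n * x ^ (2 * n) * poly W (inverse x))" by (simp add: W_def)
    also have "poly W (inverse x) = poly C (inverse x) + inverse x ^ (2 * n) * poly A (inverse x)"
      unfolding W by (simp add: poly_monom)
    also have "x ^ n * x ^ (2 * n) * \<dots> = x ^ (2 * n) * (x ^ n * poly C (inverse x))
        + x ^ n * poly A (inverse x) * (x ^ (2 * n) * inverse x ^ (2 * n))"
      by (simp only: distrib_left mult_ac)
    also have "x ^ (2 * n) * inverse x ^ (2 * n) = 1"
      using x by (simp flip: power_mult_distrib)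
    also have "- (x ^ (2 * n) * (x ^ n * poly C (inverse x)) + x ^ n * poly A (inverse x) * 1)
        = poly (- (monom 1 (2 * n) * ?r C + ?r A)) x"
      using x degC degA' by (simp add: poly_reverse_poly poly_monom)
    finally show "poly (?r f * V) x = poly (- (monom 1 (2 * n) * ?r C + ?r A)) x" .
  qed
  define L where "L = ?r f * C + f * ?r A"
  define R where "R = ?r f * A + f * ?r C"
  \<comment> \<open>\<open>V\<close> is eliminated by writing the product of \<open>f\<close>, its
    reversal and \<open>V\<close> in two ways, through \<open>W\<close> and through
    \<open>rV\<close>.\<close>
  have LR: "L + monom 1 (2 * n) * R = 0"
  proof -
    have "L + monom 1 (2 * n) * R = ?r f * W + f * (monom 1 (2 * n) * ?r C + ?r A)"
      unfolding L_def R_def W by (simp add: algebra_simps)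
    also have "\<dots> = f * (?r f * V) + f * (monom 1 (2 * n) * ?r C + ?r A)"
      by (simp add: W_def mult_ac)
    finally show ?thesis unfolding rV by (simp only: mult_minus_right add.left_inverse)
  qed
  have degL: "degree L \<le> 2 * n"
  proof -
    have "degree (?r f * C) \<le> 2 * n" "degree (f * ?r A) \<le> 2 * n"
      using degree_mult_le[of "?r f" C] degree_mult_le[of f "?r A"] degree_reverse_poly_le[of f n]
        degree_reverse_poly_le[OF degA'] degf degC by linarith+
    then show ?thesis unfolding L_def by (rule degree_add_le)
  qed
  \<comment> \<open>\<open>L\<close> has degree at most \<open>2 * n\<close>, so nothing can cancel
    the terms of positive degree in \<open>R\<close>.\<close>
  have "degree R = 0"
  proof -
    have "coeff R l = 0" if "l > 0" for l
      using arg_cong[OF LR, of "\<lambda>p. coeff p (2 * n + l)"] degL that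
      by (simp add: coeff_monom_mult coeff_eq_0)
    then show ?thesis using degree_le[of 0 R] by simp
  qed
  then obtain c where c: "R = [:c:]" using degree_eq_zeroE by blast
  \<comment> \<open>Reversal preserves the value at 1, so \<open>L\<close> and \<open>R\<close>
    agree there; their values also sum to 0, hence the constant \<open>R\<close> vanishes.\<close>
  have "poly L 1 = poly R 1"
    unfolding L_def R_def using degf degC degA' by (simp add: poly_reverse_poly)
  moreover have "poly L 1 + poly R 1 = 0"
    using arg_cong[OF LR, of "\<lambda>p. poly p 1"] by (simp add: poly_monom)
  ultimately have "R = 0" using c by simp
  then have rfA: "?r f * A = - (f * ?r C)" unfolding R_def by (simp add: add_eq_0_iff2)
  then have "f dvd ?r f * A" by simp
  then have "f dvd A"
    using coprime_reverse_expansive[OF exp] degf by (simp add: coprime_dvd_mult_right_iff)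
  \<comment> \<open>A nonzero multiple of \<open>f\<close> has degree at least \<open>Suc m\<close>,
    but \<open>degree A \<le> m\<close>.\<close>
  then have "A = 0" using degA deg dvd_imp_degree_le[of f A] by fastforce
  moreover from this have "C = 0" using rfA f0 by simp
  ultimately have "?r f * V = 0" using rV by (simp add: reverse_poly_def)
  then have "V = 0" using f0 by simp
  then show False using coeff_V k by simp
qed

section \<open>From nonzero integers to the bounds on roots\<close>

text \<open>Multiply by \<open>\<rho>\<close>, then divide by \<open>\<rho> - 1\<close>, using
  \<rho> / (\<rho> - 1) = 1 + 1 / (\<rho> - 1).\<close>

lemma inverse_cmod_root_le:
  fixes B \<rho> :: real
  assumes "\<rho> > 1" and "1 \<le> (1 - 1 / \<rho>) * B"
  shows "1 / (\<rho> - 1) \<le> B - 1"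
proof -
  have "\<rho> \<le> (\<rho> - 1) * B" using assms by (simp add: field_simps)
  then show ?thesis using assms(1) by (simp add: field_simps)
qed

lemma real_root_bound:
  fixes f :: "int poly" and r :: real
  assumes root: "poly (map_poly of_int f) r = 0" and r: "\<bar>r\<bar> > 1"
    and sgn: "poly f (if r > 0 then 1 else - 1) \<noteq> 0"
  shows "1 \<le> (1 - 1 / \<bar>r\<bar>) * (real ((degree f + 1) choose 2) * of_int (height f))"
proof -
  define n where "n = degree f"
  define \<epsilon> :: int where "\<epsilon> = (if r > 0 then 1 else - 1)"
  define b where "b = 1 / \<bar>r\<bar>"
  have b: "0 \<le> b" "b \<le> 1" using r by (auto simp: b_def)
  have re: "r * b = of_int \<epsilon>" using r by (auto simp: b_def \<epsilon>_def)
  \<comment> \<open>Since \<open>r * b\<close> is the sign of \<open>r\<close>, scaling the root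
    equation by \<open>b ^ n\<close> turns r^k into \<epsilon>^k b^(n-k). Subtracting it from
    f(\<epsilon>) leaves the factors 1 - b^(n-k).\<close>
  have "b ^ n * (\<Sum>k\<le>n. of_int (coeff f k) * r ^ k) = 0"
    using root by (simp add: poly_altdef coeff_map_poly degree_map_poly n_def)
  also have "b ^ n * (\<Sum>k\<le>n. of_int (coeff f k) * r ^ k)
      = (\<Sum>k\<le>n. of_int (coeff f k) * of_int \<epsilon> ^ k * b ^ (n - k))"
    unfolding sum_distrib_left
  proof (rule sum.cong[OF refl])
    fix k assume "k \<in> {..n}"
    then have "b ^ n = b ^ k * b ^ (n - k)" by (simp flip: power_add)
    then show "b ^ n * (of_int (coeff f k) * r ^ k) = of_int (coeff f k) * of_int \<epsilon> ^ k * b ^ (n - k)"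
      by (simp add: power_mult_distrib mult_ac flip: re)
  qed
  finally have zero: "(\<Sum>k\<le>n. of_int (coeff f k) * of_int \<epsilon> ^ k * b ^ (n - k)) = 0" .
  have "1 \<le> \<bar>real_of_int (poly f \<epsilon>)\<bar>"
    using sgn unfolding \<epsilon>_def by linarith
  also have "real_of_int (poly f \<epsilon>) = (\<Sum>k\<le>n. of_int (coeff f k) * of_int \<epsilon> ^ k)"
    by (simp add: poly_altdef n_def)
  also have "\<dots> = (\<Sum>k\<le>n. of_int (coeff f k) * of_int \<epsilon> ^ k * (1 - b ^ (n - k)))"
    using zero by (simp add: right_diff_distrib sum_subtractf)
  also have "\<bar>\<dots>\<bar> \<le> (\<Sum>k\<le>n. of_int (height f) * (real (n - k) * (1 - b)))"
  proof (rule order_trans[OF sum_abs], rule sum_mono)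
    fix k
    have "\<bar>of_int (coeff f k)\<bar> \<le> (of_int (height f) :: real)"
      using abs_coeff_le_height[of f k] by linarith
    moreover have "\<bar>1 - b ^ (n - k)\<bar> \<le> real (n - k) * (1 - b)"
      using one_minus_power_le[OF b, of "n - k"] power_le_one[OF b, of "n - k"] by simp
    moreover have "\<bar>real_of_int \<epsilon> ^ k\<bar> = 1" by (simp add: \<epsilon>_def power_abs)
    ultimately show "\<bar>of_int (coeff f k) * of_int \<epsilon> ^ k * (1 - b ^ (n - k))\<bar>
        \<le> of_int (height f) * (real (n - k) * (1 - b))"
      unfolding abs_mult by (intro mult_mono) auto
  qed
  also have "\<dots> = (1 - b) * (real (\<Sum>k\<le>n. n - k) * of_int (height f))"
    by (simp add: sum_distrib_left sum_distrib_right mult_ac)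
  also have "(\<Sum>k\<le>n. n - k) = (n + 1) choose 2"
  proof -
    have "(\<Sum>k\<le>n. n - k) = (\<Sum>k\<le>n. k)"
      by (rule sum.reindex_bij_witness[of _ "\<lambda>k. n - k" "\<lambda>k. n - k"]) auto
    also have "\<dots> = (n + 1) choose 2" by (induction n) (simp_all add: numeral_2_eq_2)
    finally show ?thesis .
  qed
  finally show ?thesis by (simp add: b_def n_def)
qed

lemma map_mat_root_pair_mat:
  "map_mat of_int (root_pair_mat m (coeff f) 1) = root_pair_mat m (coeff (map_poly of_int f)) 1"
  by (rule eq_matI) (auto simp: root_pair_mat_def coeff_map_poly)

text \<open>One integer determinant is viewed in two fields: over the complex numbers it is nonzero,
  hence at least 1 in absolute value; over the reals it is compared with the determinant that
  vanishes at 1 / |\<alpha>|.\<close>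

lemma nonreal_root_bound:
  fixes f :: "int poly" and \<alpha> :: complex
  assumes deg: "degree f = Suc m" and exp: "expansive (map_poly of_int f)"
    and root: "poly (map_poly of_int f) \<alpha> = 0" and nonreal: "\<alpha> \<notin> \<real>"
  shows "1 \<le> (1 - 1 / cmod \<alpha>) * (real (Suc m choose 2) * fact (Suc m) * of_int (height f) ^ m)"
proof -
  let ?g = "map_poly of_int f :: real poly" and ?h = "map_poly of_int f :: complex poly"
  let ?D = "det (root_pair_mat m (coeff f) 1)"
  have \<alpha>: "cmod \<alpha> > 1" using exp root by (simp add: expansive_def)
  \<comment> \<open>A polynomial of degree 1 with integer coefficients has a rational root, so a
    nonreal root forces degree at least 2.\<close>
  have "m > 0"
  proof (rule ccontr)
    assume "\<not> m > 0"
    then have "coeff f 1 \<noteq> 0" "of_int (coeff f 0) + of_int (coeff f 1) * \<alpha> = 0"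
      using deg leading_coeff_0_iff[of f] root
      by (auto simp: poly_altdef coeff_map_poly degree_map_poly)
    then have "\<alpha> = - of_int (coeff f 0) / of_int (coeff f 1)"
      by (simp add: field_simps add_eq_0_iff2)
    then have "\<alpha> \<in> \<real>" by simp
    then show False using nonreal by simp
  qed
  have "of_int ?D = det (root_pair_mat m (coeff ?h) 1)"
    by (simp flip: of_int_hom.hom_det add: map_mat_root_pair_mat)
  moreover have "det (root_pair_mat m (coeff ?h) 1) \<noteq> 0"
    using deg exp by (intro det_root_pair_mat_expansive) (simp_all add: degree_map_poly)
  ultimately have "?D \<noteq> 0" by auto
  then have "1 \<le> \<bar>real_of_int ?D\<bar>" by linarith
  also have "real_of_int ?D = det (root_pair_mat m (coeff ?g) 1)"
    by (simp flip: of_int_hom.hom_det add: map_mat_root_pair_mat)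
  also have "\<dots> = \<dots> - det (root_pair_mat m (coeff ?g) (1 / cmod \<alpha>))"
  proof -
    have "map_poly of_real ?g = ?h" by (simp add: map_poly_map_poly o_def)
    then have "det (root_pair_mat m (coeff ?g) (1 / cmod \<alpha>)) = 0"
      using deg \<open>m > 0\<close> root nonreal
      by (intro det_root_pair_mat_inverse_cmod_root) (simp_all add: degree_map_poly)
    then show ?thesis by simp
  qed
  also have "\<bar>\<dots>\<bar> \<le> (1 - 1 / cmod \<alpha>) * (real (Suc m choose 2) * fact (Suc m) * of_int (height f) ^ m)"
  proof (rule abs_det_root_pair_mat_diff_le)
    show "\<bar>coeff ?g k\<bar> \<le> of_int (height f)" for k
      using abs_coeff_le_height[of f k] by (simp add: coeff_map_poly)
    show "coeff ?g k = 0" if "k > Suc m" for k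
      using that deg by (simp add: coeff_map_poly coeff_eq_0)
  qed (use \<alpha> in \<open>simp_all add: divide_le_eq\<close>)
  finally show ?thesis .
qed

theorem theorem4p5:
  fixes f :: "int poly" and n :: nat and \<alpha> :: complex
  assumes "degree f = n"
    and "n \<ge> 1"
    and "expansive (map_poly of_int f)"
    and "poly (map_poly of_int f) \<alpha> = 0"
  shows "1 / (cmod \<alpha> - 1) \<le>
    (if \<alpha> \<in> \<real>
     then real ((n + 1) choose 2) * of_int (height f) + real n / 2
     else real (n choose 2) * fact n * of_int (height f) ^ (n - 1) + real (n choose 2) + 1)"
proof (cases "\<alpha> \<in> \<real>")
  case True
  then obtain r where r: "\<alpha> = of_real r" by (auto elim: Reals_cases)
  have \<alpha>: "cmod \<alpha> > 1" using assms(3,4) by (simp add: expansive_def)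
  have "of_real (poly (map_poly of_int f) r) = poly (map_poly of_int f) \<alpha>"
    by (simp add: r poly_altdef coeff_map_poly degree_map_poly)
  then have root: "poly (map_poly of_int f) r = 0"
    using assms(4) by simp
  \<comment> \<open>1 and -1 lie on the unit circle, so neither can be a root of an expansive
    polynomial.\<close>
  have "poly f \<epsilon> \<noteq> 0" if "\<bar>\<epsilon>\<bar> = 1" for \<epsilon> :: int
  proof
    assume "poly f \<epsilon> = 0"
    moreover have "poly (map_poly of_int f) (of_int \<epsilon>) = complex_of_int (poly f \<epsilon>)"
      by (simp add: poly_altdef coeff_map_poly degree_map_poly)
    ultimately have "poly (map_poly of_int f) (of_int \<epsilon> :: complex) = 0" by simp
    then have "cmod (of_int \<epsilon>) > 1" using assms(3) unfolding expansive_def by blast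
    then show False using that by simp
  qed
  then have "1 \<le> (1 - 1 / \<bar>r\<bar>) * (real ((n + 1) choose 2) * of_int (height f))"
    using real_root_bound[OF root] \<alpha> assms(1) by (simp add: r)
  then have "1 / (cmod \<alpha> - 1) \<le> real ((n + 1) choose 2) * of_int (height f) - 1"
    using \<alpha> by (intro inverse_cmod_root_le) (simp_all add: r)
  also have "\<dots> \<le> real ((n + 1) choose 2) * of_int (height f) + real n / 2" by simp
  finally show ?thesis using True by simp
next
  case False
  have \<alpha>: "cmod \<alpha> > 1" using assms(3,4) by (simp add: expansive_def)
  obtain m where m: "n = Suc m" using assms(2) by (cases n) auto
  have "1 / (cmod \<alpha> - 1) \<le> real (n choose 2) * fact n * of_int (height f) ^ (n - 1) - 1"
    using nonreal_root_bound[of f m \<alpha>] assms False \<alpha> m by (intro inverse_cmod_root_le) simp_all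
  then show ?thesis using False by simp
qed

end
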